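(* Let $G=(V,E)$ be a graph. Then $\eta(I(G))\geq\rho_q^*(G)$.
   Context: The independence complex $I(G)$ is the simplicial complex on $V$ whose simplices are the independent sets of $G$. The homological connectivity $\eta(X)$ of a simplicial complex $X$ is the maximal $k$ such that $\tilde H_i(X;\mathbb{R})=0$ for all $i\leq k-2$ (reduced homology, real coefficients). A function $f:V\to\mathbb{R}_{\geq0}$ is a fractional quadratic packing of $G$ if $\sum_{u\in N_G(v)}f(u)\big(f(u)+f(v)\big)\leq 1$ for all $v\in V$, where $N_G(v)$ is the set of neighbours of $v$. $\rho_q^*(G)$ is the supremum of $\sum_{v\in V}f(v)^2$ over all fractional quadratic packings $f$ of $G$. *)

theory Defs
  imports Complex_Main "HOL-Library.Extended_Real" "HOL-Combinatorics.Permutations"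
begin

section \<open>Graphs and independence complexes\<close>

definition simple_graph :: "'a set \<Rightarrow> 'a set set \<Rightarrow> bool" where
  "simple_graph V E \<longleftrightarrow> finite V \<and> E \<subseteq> {{u, v} | u v. u \<in> V \<and> v \<in> V \<and> u \<noteq> v}"

definition neighbours :: "'a set set \<Rightarrow> 'a \<Rightarrow> 'a set" where
  "neighbours E v = {u. {u, v} \<in> E}"

definition independence_complex :: "'a set \<Rightarrow> 'a set set \<Rightarrow> 'a set set" where
  "independence_complex V E = {S. S \<subseteq> V \<and> (\<forall>e\<in>E. \<not> e \<subseteq> S)}"

section \<open>Reduced simplicial homology with real coefficients\<close>

text \<open>A simplicial complex is given by its set of simplices, which contains the empty simplex.
  An \<open>i\<close>-chain is a finitely supported real function on the ordered \<open>i\<close>-simplices (lists of the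
  \<open>i + 1\<close> distinct vertices) that changes by the sign of the permutation when the
  vertices are reordered; its value at \<open>[v\<^sub>0, \<dots>, v\<^sub>i]\<close> is the coefficient of that
  oriented simplex. The only ordered \<open>(-1)\<close>-simplex is the empty list, so the complex is
  augmented, and there are no nonzero chains in degrees below \<open>-1\<close>.\<close>

definition chains :: "'a set set \<Rightarrow> int \<Rightarrow> ('a list \<Rightarrow> real) set" where
  "chains X i = {c.
     finite {\<sigma>. c \<sigma> \<noteq> 0} \<and>
     (\<forall>\<sigma>. c \<sigma> \<noteq> 0 \<longrightarrow> distinct \<sigma> \<and> set \<sigma> \<in> X \<and> int (length \<sigma>) = i + 1) \<and>
     (\<forall>\<sigma> p. p permutes {..<length \<sigma>} \<longrightarrow> c (permute_list p \<sigma>) = of_int (sign p) * c \<sigma>)}"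

text \<open>The linear map with \<open>[v\<^sub>0, \<dots>, v\<^sub>i] \<mapsto> \<Sum>j. (-1)^j [v\<^sub>0, \<dots>, v\<^sub>j omitted, \<dots>, v\<^sub>i]\<close>: the
  simplices with \<open>\<tau>\<close> as a facet are the \<open>v # \<tau>\<close>, and \<open>\<tau>\<close> has coefficient \<open>1\<close> in the
  boundary of \<open>v # \<tau>\<close>. In degree \<open>0\<close> this is the augmentation.\<close>

definition boundary :: "('a list \<Rightarrow> real) \<Rightarrow> 'a list \<Rightarrow> real" where
  "boundary c \<tau> = (\<Sum>v | c (v # \<tau>) \<noteq> 0. c (v # \<tau>))"

definition cycles :: "'a set set \<Rightarrow> int \<Rightarrow> ('a list \<Rightarrow> real) set" where
  "cycles X i = {c \<in> chains X i. boundary c = (\<lambda>_. 0)}"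

definition boundaries :: "'a set set \<Rightarrow> int \<Rightarrow> ('a list \<Rightarrow> real) set" where
  "boundaries X i = boundary ` chains X (i + 1)"

definition reduced_homology :: "'a set set \<Rightarrow> int \<Rightarrow> ('a list \<Rightarrow> real) set set" where
  "reduced_homology X i =
     cycles X i // {(a, b). a \<in> cycles X i \<and> b \<in> cycles X i \<and> (\<lambda>\<sigma>. a \<sigma> - b \<sigma>) \<in> boundaries X i}"

text \<open>The zero class of the quotient is \<open>boundaries X i\<close>.\<close>

definition reduced_homology_zero :: "'a set set \<Rightarrow> int \<Rightarrow> bool" where
  "reduced_homology_zero X i \<longleftrightarrow> reduced_homology X i = {boundaries X i}"

text \<open>The value is \<open>\<infinity>\<close> when the reduced homology vanishes in every degree. Restricting to \<open>k \<ge> 0\<close>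
  loses nothing, since \<open>k = 0\<close> always qualifies.\<close>

definition homological_connectivity :: "'a set set \<Rightarrow> enat" where
  "homological_connectivity X =
     Sup {enat k | k. \<forall>i. i \<le> int k - 2 \<longrightarrow> reduced_homology_zero X i}"

section \<open>Fractional quadratic packings\<close>

definition fractional_quadratic_packing ::
    "'a set \<Rightarrow> 'a set set \<Rightarrow> ('a \<Rightarrow> real) \<Rightarrow> bool" where
  "fractional_quadratic_packing V E f \<longleftrightarrow>
     (\<forall>v\<in>V. 0 \<le> f v) \<and> (\<forall>v\<in>V. (\<Sum>u\<in>neighbours E v. f u * (f u + f v)) \<le> 1)"

text \<open>The supremum is \<open>\<infinity>\<close> when \<open>G\<close> has an isolated vertex.\<close>

definition rho_q :: "'a set \<Rightarrow> 'a set set \<Rightarrow> ereal" where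
  "rho_q V E = (SUP f \<in> {f. fractional_quadratic_packing V E f}. ereal (\<Sum>v\<in>V. (f v)\<^sup>2))"

end

theory Submission
  imports Defs
begin

text \<open>Give the vertices the weights \<open>w v = (f v)\<^sup>2\<close>, where \<open>f\<close> is made positive by a small perturbation. For a
  cycle \<open>z\<close> of degree \<open>i\<close> let \<open>\<delta> z\<close> be the exterior product of \<open>w\<close> and \<open>z\<close>, restricted to the simplices of
  \<open>I(G)\<close>, and let \<open>W = \<Sum>v. w v\<close>. On the full simplex the boundary of \<open>\<delta> z\<close> would be \<open>W z\<close>. In \<open>I(G)\<close> the
  error at a simplex \<open>\<tau>\<close> comes only from the neighbours of \<open>\<tau>\<close>, and a Gershgorin-type estimate in the
  maximum norm weighted by \<open>\<Prod>v\<in>\<tau>. f v\<close> bounds it by \<open>(i + 1) b\<close> times the norm of \<open>z\<close>, where \<open>b \<approx> 1\<close> is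
  the packing bound. So if \<open>(i + 1) b < W\<close>, the map \<open>z \<mapsto> z - \<partial>(\<delta> z) / W\<close> contracts the cycles, and its Neumann
  series writes every cycle as a boundary.\<close>

section \<open>Alternating functions on lists\<close>

text \<open>Adjacent swaps generate all permutations, so this amounts to the sign condition in
  \<open>chains\<close>. In this form it mentions no permutation of indices and suits induction on
  lists.\<close>

definition alternating :: "('a list \<Rightarrow> real) \<Rightarrow> bool" where
  "alternating c \<longleftrightarrow> (\<forall>xs a b ys. c (xs @ a # b # ys) = - c (xs @ b # a # ys))"

lemma permute_list_adjacent:
  "permute_list (Transposition.transpose (length xs) (Suc (length xs))) (xs @ a # b # ys) = xs @ b # a # ys"
proof (rule nth_equalityI)
  let ?n = "length xs"
  fix k
  assume k: "k < length (permute_list (Transposition.transpose ?n (Suc ?n)) (xs @ a # b # ys))"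
  then have "permute_list (Transposition.transpose ?n (Suc ?n)) (xs @ a # b # ys) ! k
      = (xs @ a # b # ys) ! Transposition.transpose ?n (Suc ?n) k"
    by (simp add: permute_list_def del: upt_Suc)
  also have "\<dots> = (xs @ b # a # ys) ! k"
  proof (cases "k < ?n")
    case False
    then obtain m where "k = ?n + m" using le_Suc_ex not_less by blast
    then show ?thesis
      by (cases m rule: nat.exhaust; cases "m - 1")
        (auto simp: Transposition.transpose_def nth_append)
  qed (simp add: nth_append)
  finally show "permute_list (Transposition.transpose ?n (Suc ?n)) (xs @ a # b # ys) ! k
      = (xs @ b # a # ys) ! k" .
qed simp

lemma alternating_permute_adjacent:
  assumes c: "alternating c" and i: "Suc i < length \<sigma>"
  shows "c (permute_list (Transposition.transpose i (Suc i)) \<sigma>) = - c \<sigma>"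
proof -
  define xs a b ys
    where d: "xs = take i \<sigma>" "a = \<sigma> ! i" "b = \<sigma> ! Suc i" "ys = drop (Suc (Suc i)) \<sigma>"
  have "drop i \<sigma> = a # b # ys"
    using i by (simp add: d Cons_nth_drop_Suc)
  then have \<sigma>: "\<sigma> = xs @ a # b # ys"
    using append_take_drop_id[of i \<sigma>] by (simp add: d(1))
  have "length xs = i" using i by (simp add: d)
  then have "permute_list (Transposition.transpose i (Suc i)) \<sigma> = xs @ b # a # ys"
    unfolding \<sigma> using permute_list_adjacent[of xs a b ys] by simp
  moreover have "c (xs @ b # a # ys) = - c (xs @ a # b # ys)"
    using c unfolding alternating_def by blast
  ultimately show ?thesis by (simp add: \<sigma>)
qed

text \<open>Induction on the distance: (i j) is (i+1 j) conjugated by the adjacent swap of i and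
  i+1, which makes three sign changes in all.\<close>

lemma alternating_permute_transpose:
  assumes c: "alternating c" and "i < j" "j < length \<sigma>"
  shows "c (permute_list (Transposition.transpose i j) \<sigma>) = - c \<sigma>"
  using assms(2,3)
proof (induction "j - Suc i" arbitrary: i \<sigma>)
  case 0
  then have "j = Suc i" by simp
  then show ?case
    using 0 alternating_permute_adjacent[OF c] by simp
next
  case (Suc k)
  let ?t = "Transposition.transpose i (Suc i)"
  let ?s = "Transposition.transpose (Suc i) j"
  have t: "?t permutes {..<length \<sigma>}" and s: "?s permutes {..<length \<sigma>}"
    using Suc.prems Suc.hyps(2) by (auto intro!: permutes_swap_id)
  have eq: "Transposition.transpose i j = ?t \<circ> ?s \<circ> ?t"
    using Suc.prems Suc.hyps(2) by (auto simp: fun_eq_iff Transposition.transpose_def)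
  have adj: "c (permute_list ?t \<rho>) = - c \<rho>" if "length \<rho> = length \<sigma>" for \<rho>
    using Suc.prems Suc.hyps(2) that by (intro alternating_permute_adjacent[OF c]) simp
  have "permute_list (Transposition.transpose i j) \<sigma> = permute_list ?t (permute_list ?s (permute_list ?t \<sigma>))"
    using s t unfolding eq by (simp add: permute_list_compose)
  also have "c \<dots> = - c (permute_list ?s (permute_list ?t \<sigma>))"
    by (simp add: adj)
  also have "\<dots> = c (permute_list ?t \<sigma>)"
    using Suc.hyps(1)[of "Suc i" "permute_list ?t \<sigma>"] Suc.prems Suc.hyps(2) by simp
  also have "\<dots> = - c \<sigma>"
    by (simp add: adj)
  finally show ?case .
qed

lemma alternating_iff_permute:
  "alternating c \<longleftrightarrow>
    (\<forall>\<sigma> p. p permutes {..<length \<sigma>} \<longrightarrow> c (permute_list p \<sigma>) = of_int (sign p) * c \<sigma>)"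
proof
  assume c: "alternating c"
  show "\<forall>\<sigma> p. p permutes {..<length \<sigma>} \<longrightarrow> c (permute_list p \<sigma>) = of_int (sign p) * c \<sigma>"
  proof (intro allI impI)
    fix \<sigma> :: "'a list" and p
    assume "p permutes {..<length \<sigma>}"
    from this finite_lessThan
    \<comment> \<open>All lists of this length are treated at once, since the induction step applies
      the hypothesis to an already permuted list.\<close>
    have "\<forall>\<rho>. length \<rho> = length \<sigma> \<longrightarrow> c (permute_list p \<rho>) = of_int (sign p) * c \<rho>"
    proof (induction rule: permutes_induct)
      case id
      then show ?case by simp
    next
      case (swap a b p)
      have *: "c (permute_list (Transposition.transpose a b) \<rho>) = - c \<rho>"
        if "length \<rho> = length \<sigma>" for \<rho>
        using swap alternating_permute_transpose[OF c, of a b \<rho>]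
          alternating_permute_transpose[OF c, of b a \<rho>] that
        by (cases a b rule: linorder_cases) (auto simp: transpose_commute)
      have "permutation p"
        using swap(4) permutes_imp_permutation by blast
      then have "sign (Transposition.transpose a b \<circ> p) = - sign p"
        using swap by (simp add: sign_compose permutation_swap_id sign_swap_id)
      moreover have "permute_list (Transposition.transpose a b \<circ> p) \<rho>
          = permute_list p (permute_list (Transposition.transpose a b) \<rho>)"
        if "length \<rho> = length \<sigma>" for \<rho>
        using swap.hyps swap.IH that by (intro permute_list_compose) auto
      ultimately show ?case
        using swap.IH * by (metis length_permute_list mult_minus_left mult_minus_right of_int_minus)
    qed
    then show "c (permute_list p \<sigma>) = of_int (sign p) * c \<sigma>" by simp
  qed
next
  assume perm: "\<forall>\<sigma> p. p permutes {..<length \<sigma>} \<longrightarrow> c (permute_list p \<sigma>) = of_int (sign p) * c \<sigma>"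
  show "alternating c"
    unfolding alternating_def
  proof (intro allI)
    fix xs ys :: "'a list" and a b
    let ?t = "Transposition.transpose (length xs) (Suc (length xs))"
    have "?t permutes {..<length (xs @ b # a # ys)}"
      by (auto intro!: permutes_swap_id)
    then have "c (permute_list ?t (xs @ b # a # ys)) = of_int (sign ?t) * c (xs @ b # a # ys)"
      using perm by blast
    then show "c (xs @ a # b # ys) = - c (xs @ b # a # ys)"
      by (simp add: permute_list_adjacent sign_swap_id)
  qed
qed

text \<open>Swapping two equal entries fixes the list but negates the value.\<close>

lemma alternating_not_distinct:
  assumes "alternating c" "\<not> distinct \<sigma>"
  shows "c \<sigma> = 0"
proof -
  obtain i j where ij: "i < j" "j < length \<sigma>" "\<sigma> ! i = \<sigma> ! j"
    using assms(2) by (metis distinct_conv_nth nat_neq_iff)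
  have "permute_list (Transposition.transpose i j) \<sigma> = \<sigma>"
    using ij by (intro nth_equalityI) (auto simp: permute_list_def Transposition.transpose_def)
  then show ?thesis
    using alternating_permute_transpose[OF assms(1) ij(1,2)] by simp
qed

section \<open>The augmented chain complex and vanishing reduced homology\<close>

lemma chains_iff:
  "c \<in> chains X i \<longleftrightarrow> finite {\<sigma>. c \<sigma> \<noteq> 0} \<and>
     (\<forall>\<sigma>. c \<sigma> \<noteq> 0 \<longrightarrow> distinct \<sigma> \<and> set \<sigma> \<in> X \<and> int (length \<sigma>) = i + 1) \<and> alternating c"
  by (simp add: chains_def alternating_iff_permute)

text \<open>Finiteness of the support is automatic over a finite vertex set: only finitely many
  lists have the given length.\<close>

lemma chainsI:
  assumes V: "finite V" "X \<subseteq> Pow V"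
    and supp: "\<And>\<sigma>. c \<sigma> \<noteq> 0 \<Longrightarrow> distinct \<sigma> \<and> set \<sigma> \<in> X \<and> int (length \<sigma>) = i + 1"
    and alt: "alternating c"
  shows "c \<in> chains X i"
proof -
  have "{\<sigma>. c \<sigma> \<noteq> 0} \<subseteq> {\<sigma>. set \<sigma> \<subseteq> V \<and> length \<sigma> = nat (i + 1)}"
    using supp V by fastforce
  then have "finite {\<sigma>. c \<sigma> \<noteq> 0}"
    using finite_lists_length_eq[OF V(1)] finite_subset by blast
  then show ?thesis
    using supp alt by (simp add: chains_iff)
qed

lemma boundary_eq_sum:
  assumes "finite V" "X \<subseteq> Pow V" "c \<in> chains X i"
  shows "boundary c \<tau> = (\<Sum>v\<in>V. c (v # \<tau>))"
  unfolding boundary_def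
proof (rule sum.mono_neutral_left)
  show "{v. c (v # \<tau>) \<noteq> 0} \<subseteq> V"
    using assms by (fastforce simp: chains_iff)
qed (use assms in auto)

lemma boundary_in_chains:
  assumes V: "finite V" "X \<subseteq> Pow V" and down: "\<forall>S\<in>X. \<forall>T\<subseteq>S. T \<in> X"
    and c: "c \<in> chains X (i + 1)"
  shows "boundary c \<in> chains X i"
proof (rule chainsI[OF V])
  fix \<tau>
  assume "boundary c \<tau> \<noteq> 0"
  then obtain v where "c (v # \<tau>) \<noteq> 0"
    unfolding boundary_def by (metis (mono_tags, lifting) mem_Collect_eq sum.neutral)
  then have "distinct (v # \<tau>) \<and> set (v # \<tau>) \<in> X \<and> int (length (v # \<tau>)) = i + 1 + 1"
    using c unfolding chains_iff by blast
  moreover from this have "set \<tau> \<in> X"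
    using down set_subset_Cons by metis
  ultimately show "distinct \<tau> \<and> set \<tau> \<in> X \<and> int (length \<tau>) = i + 1"
    by simp
next
  have "alternating c" using c by (simp add: chains_iff)
  then have swap: "c (v # xs @ a # b # ys) = - c (v # xs @ b # a # ys)" for v xs a b ys
    unfolding alternating_def by (metis append_Cons)
  show "alternating (boundary c)"
    unfolding alternating_def boundary_eq_sum[OF V c] sum_negf[symmetric]
    by (intro allI sum.cong refl swap)
qed

lemma boundary_boundary:
  assumes V: "finite V" "X \<subseteq> Pow V" and down: "\<forall>S\<in>X. \<forall>T\<subseteq>S. T \<in> X"
    and c: "c \<in> chains X (i + 1)"
  shows "boundary (boundary c) = (\<lambda>_. 0)"
proof
  fix \<tau>
  have "alternating c" using c by (simp add: chains_iff)
  then have alt: "c (u # v # \<tau>) = - c (v # u # \<tau>)" for u v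
    unfolding alternating_def by (metis append_Nil)
  have "boundary (boundary c) \<tau> = (\<Sum>v\<in>V. \<Sum>u\<in>V. c (u # v # \<tau>))" (is "_ = ?S")
    by (simp add: boundary_eq_sum[OF V boundary_in_chains[OF V down c]] boundary_eq_sum[OF V c])
  \<comment> \<open>Exchanging the two summation variables and then the two leading entries turns
    the double sum into its own negative.\<close>
  also have "?S = - ?S"
    by (subst sum.swap, subst alt) (simp add: sum_negf)
  then have "?S = 0" by simp
  finally show "boundary (boundary c) \<tau> = 0" .
qed

lemma chains_diff_scale:
  assumes "finite V" "X \<subseteq> Pow V" "a \<in> chains X i" "b \<in> chains X i"
  shows "(\<lambda>\<sigma>. a \<sigma> - r * b \<sigma>) \<in> chains X i"
proof (rule chainsI[OF assms(1,2)])
  show "alternating (\<lambda>\<sigma>. a \<sigma> - r * b \<sigma>)"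
    unfolding alternating_def
  proof (intro allI)
    fix xs ys u v
    have "a (xs @ u # v # ys) = - a (xs @ v # u # ys)" "b (xs @ u # v # ys) = - b (xs @ v # u # ys)"
      using assms(3,4) unfolding chains_iff alternating_def by blast+
    then show "a (xs @ u # v # ys) - r * b (xs @ u # v # ys)
        = - (a (xs @ v # u # ys) - r * b (xs @ v # u # ys))"
      by simp
  qed
next
  fix \<sigma>
  assume "a \<sigma> - r * b \<sigma> \<noteq> 0"
  then have "a \<sigma> \<noteq> 0 \<or> b \<sigma> \<noteq> 0" by auto
  then show "distinct \<sigma> \<and> set \<sigma> \<in> X \<and> int (length \<sigma>) = i + 1"
    using assms(3,4) unfolding chains_iff by blast
qed

lemma cycles_diff_scale:
  assumes V: "finite V" "X \<subseteq> Pow V" and a: "a \<in> cycles X i" and b: "b \<in> cycles X i"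
  shows "(\<lambda>\<sigma>. a \<sigma> - r * b \<sigma>) \<in> cycles X i"
proof -
  have ac: "a \<in> chains X i" and bc: "b \<in> chains X i"
    using a b by (auto simp: cycles_def)
  have "(\<Sum>v\<in>V. a (v # \<tau>)) = 0" "(\<Sum>v\<in>V. b (v # \<tau>)) = 0" for \<tau>
    using a b boundary_eq_sum[OF V ac] boundary_eq_sum[OF V bc] by (auto simp: cycles_def fun_eq_iff)
  then show ?thesis
    using chains_diff_scale[OF V ac bc]
    by (auto simp: cycles_def fun_eq_iff boundary_eq_sum[OF V chains_diff_scale[OF V ac bc]]
        sum_subtractf sum_distrib_left[symmetric])
qed

text \<open>The converse inclusion is \<partial>\<partial> = 0, so the equivalence relation
  identifies all cycles.\<close>

lemma reduced_homology_zeroI: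
  assumes V: "finite V" "X \<subseteq> Pow V" and down: "\<forall>S\<in>X. \<forall>T\<subseteq>S. T \<in> X"
    and sub: "cycles X i \<subseteq> boundaries X i"
  shows "reduced_homology_zero X i"
proof -
  have "boundaries X i \<subseteq> cycles X i"
    using boundary_in_chains[OF V down] boundary_boundary[OF V down]
    by (auto simp: boundaries_def cycles_def)
  with sub have eq: "boundaries X i = cycles X i" by blast
  \<comment> \<open>The zero cycle makes the quotient nonempty: there is exactly one class instead
    of none.\<close>
  have "(\<lambda>_. 0) \<in> cycles X i"
    by (auto simp: cycles_def boundary_def chains_iff alternating_def)
  moreover have "(\<lambda>\<sigma>. a \<sigma> - b \<sigma>) \<in> boundaries X i" if "a \<in> cycles X i" "b \<in> cycles X i" for a b
    using cycles_diff_scale[OF V that, of 1] eq by simp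
  ultimately show ?thesis
    unfolding reduced_homology_zero_def reduced_homology_def quotient_def eq by auto
qed

section \<open>Exterior multiplication by a weight vector\<close>

text \<open>The sign is that of moving the \<open>i\<close>-th entry to the front: for alternating
  \<open>c\<close> this is the coefficient at \<open>\<sigma>\<close> of the exterior product of the
  vector \<open>w\<close> with \<open>c\<close>.\<close>

definition wedge :: "('a \<Rightarrow> real) \<Rightarrow> ('a list \<Rightarrow> real) \<Rightarrow> 'a list \<Rightarrow> real" where
  "wedge w c \<sigma> = (\<Sum>i<length \<sigma>. (- 1) ^ i * w (\<sigma> ! i) * c (take i \<sigma> @ drop (Suc i) \<sigma>))"

text \<open>Behind the head every position is shifted by one, hence the minus sign. The recursion
  carries the induction in \<open>alternating_wedge\<close> and yields the anticommutation with
  \<open>boundary\<close>.\<close>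

lemma wedge_Cons: "wedge w c (v # \<tau>) = w v * c \<tau> - wedge w (\<lambda>\<rho>. c (v # \<rho>)) \<tau>"
  by (simp add: wedge_def sum.lessThan_Suc_shift sum_negf del: sum.lessThan_Suc)

lemma wedge_uminus: "wedge w (\<lambda>\<rho>. - c \<rho>) \<tau> = - wedge w c \<tau>"
  by (simp add: wedge_def sum_negf)

lemma wedge_sum: "wedge w (\<lambda>\<rho>. \<Sum>v\<in>V. c v \<rho>) \<tau> = (\<Sum>v\<in>V. wedge w (c v) \<tau>)"
  unfolding wedge_def sum_distrib_left by (rule sum.swap)

lemma wedge_sums:
  assumes "\<And>\<sigma>. (\<lambda>m. a m \<sigma>) sums c \<sigma>"
  shows "(\<lambda>m. wedge w (a m) \<sigma>) sums wedge w c \<sigma>"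
  unfolding wedge_def by (intro sums_sum sums_mult assms)

lemma alternating_wedge:
  assumes "alternating c"
  shows "alternating (wedge w c)"
proof -
  have "wedge w c (xs @ a # b # ys) = - wedge w c (xs @ b # a # ys)" for xs a b ys
    using assms
  proof (induction xs arbitrary: c)
    \<comment> \<open>After two expansions the swap exchanges the terms with factors
      \<open>w a\<close> and \<open>w b\<close>, which have opposite signs; the remaining term
      changes sign with \<open>c\<close>.\<close>
    case Nil
    then have "(\<lambda>\<rho>. c (a # b # \<rho>)) = (\<lambda>\<rho>. - c (b # a # \<rho>))"
      unfolding alternating_def by (metis append_Nil)
    then show ?case
      by (simp add: wedge_Cons wedge_uminus)
  next
    case (Cons x xs)
    have "alternating (\<lambda>\<rho>. c (x # \<rho>))"
      using Cons.prems unfolding alternating_def by (metis append_Cons)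
    moreover have "c (xs @ a # b # ys) = - c (xs @ b # a # ys)"
      using Cons.prems unfolding alternating_def by blast
    ultimately show ?case
      using Cons.IH[of "\<lambda>\<rho>. c (x # \<rho>)"] by (simp add: wedge_Cons)
  qed
  then show ?thesis unfolding alternating_def by blast
qed

text \<open>For \<open>w\<close> constantly 1 this is the simplicial coboundary of \<open>X\<close>.
  The cut-off is needed because all facets of a list can be simplices without the list being
  one.\<close>

definition coboundary :: "'a set set \<Rightarrow> ('a \<Rightarrow> real) \<Rightarrow> ('a list \<Rightarrow> real) \<Rightarrow> 'a list \<Rightarrow> real" where
  "coboundary X w c \<sigma> = (if set \<sigma> \<in> X then wedge w c \<sigma> else 0)"

lemma coboundary_in_chains:
  assumes V: "finite V" "X \<subseteq> Pow V" and c: "c \<in> chains X i"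
  shows "coboundary X w c \<in> chains X (i + 1)"
proof (rule chainsI[OF V])
  have alt: "alternating (wedge w c)"
    using c by (simp add: chains_iff alternating_wedge)
  then have swap: "wedge w c (xs @ a # b # ys) = - wedge w c (xs @ b # a # ys)" for xs a b ys
    unfolding alternating_def by blast
  show "alternating (coboundary X w c)"
    unfolding alternating_def
  proof (intro allI)
    fix xs ys :: "'a list" and a b
    have set_eq: "set (xs @ a # b # ys) = set (xs @ b # a # ys)" by auto
    show "coboundary X w c (xs @ a # b # ys) = - coboundary X w c (xs @ b # a # ys)"
      unfolding coboundary_def set_eq swap[of xs a b ys] by simp
  qed
  fix \<sigma>
  assume nz: "coboundary X w c \<sigma> \<noteq> 0"
  then have X: "set \<sigma> \<in> X" and wz: "wedge w c \<sigma> \<noteq> 0"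
    by (auto simp: coboundary_def split: if_splits)
  have "distinct \<sigma>"
    using alternating_not_distinct[OF alt] wz by blast
  obtain j where "j < length \<sigma>" "c (take j \<sigma> @ drop (Suc j) \<sigma>) \<noteq> 0"
    using wz unfolding wedge_def
    by (metis (no_types, lifting) lessThan_iff mult_zero_right sum.neutral)
  moreover from this have "int (length (take j \<sigma> @ drop (Suc j) \<sigma>)) = i + 1"
    using c unfolding chains_iff by blast
  ultimately show "distinct \<sigma> \<and> set \<sigma> \<in> X \<and> int (length \<sigma>) = i + 1 + 1"
    using X \<open>distinct \<sigma>\<close> by auto
qed

text \<open>On the full simplex, \<open>boundary\<close> and \<open>wedge w\<close> anticommute to the scalar \<open>\<Sum>v\<in>V. w v\<close>. The
  error term below counts only the vertices by which \<open>\<tau>\<close> cannot be extended inside \<open>X\<close>.\<close>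

lemma boundary_coboundary_cycle:
  assumes V: "finite V" "X \<subseteq> Pow V" and z: "z \<in> cycles X i" and \<tau>: "set \<tau> \<in> X"
  shows "boundary (coboundary X w z) \<tau> =
    (\<Sum>v\<in>V. w v) * z \<tau> - (\<Sum>v\<in>{v\<in>V. insert v (set \<tau>) \<notin> X}. wedge w z (v # \<tau>))"
proof -
  have zc: "z \<in> chains X i" and bz: "boundary z = (\<lambda>_. 0)"
    using z by (auto simp: cycles_def)
  \<comment> \<open>By linearity the sum over the head vertex moves inside the wedge and becomes the
    boundary of a cycle.\<close>
  have "(\<Sum>v\<in>V. wedge w (\<lambda>\<rho>. z (v # \<rho>)) \<tau>) = wedge w (boundary z) \<tau>"
    unfolding boundary_eq_sum[OF V zc, abs_def] wedge_sum ..
  also have "\<dots> = 0" by (simp add: bz wedge_def)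
  finally have "(\<Sum>v\<in>V. wedge w z (v # \<tau>)) = (\<Sum>v\<in>V. w v) * z \<tau>"
    by (simp add: wedge_Cons sum_subtractf sum_distrib_right)
  moreover have "(\<Sum>v\<in>V. wedge w z (v # \<tau>)) = (\<Sum>v\<in>V. coboundary X w z (v # \<tau>))
      + (\<Sum>v\<in>{v\<in>V. insert v (set \<tau>) \<notin> X}. wedge w z (v # \<tau>))"
    unfolding sum.inter_filter[OF V(1)] sum.distrib[symmetric]
    by (intro sum.cong) (auto simp: coboundary_def)
  ultimately show ?thesis
    using boundary_eq_sum[OF V coboundary_in_chains[OF V zc]] by simp
qed

section \<open>The Neumann series of a contraction on cycles\<close>

text \<open>With R = id - r \<partial>\<delta>, the series c of all R^m z converges geometrically in
  the maximum norm weighted by \<open>N\<close>. Telescoping gives c - R c = z, that is, z =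
  \<partial>(r \<delta> c).\<close>

lemma cycle_is_boundary_of_contraction:
  fixes N :: "'a list \<Rightarrow> real"
  assumes V: "finite V" "X \<subseteq> Pow V" and down: "\<forall>S\<in>X. \<forall>T\<subseteq>S. T \<in> X"
    and N: "\<And>\<sigma>. set \<sigma> \<in> X \<Longrightarrow> 0 < N \<sigma>" and q: "0 \<le> q" "q < 1"
    and contr: "\<And>c K \<tau>. \<lbrakk>c \<in> cycles X i; 0 \<le> K; \<And>\<sigma>. set \<sigma> \<in> X \<Longrightarrow> \<bar>c \<sigma>\<bar> \<le> K * N \<sigma>;
        set \<tau> \<in> X; int (length \<tau>) = i + 1\<rbrakk>
      \<Longrightarrow> \<bar>c \<tau> - r * boundary (coboundary X w c) \<tau>\<bar> \<le> q * K * N \<tau>"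
    and z: "z \<in> cycles X i"
  shows "z \<in> boundaries X i"
proof -
  define R where "R c = (\<lambda>\<tau>. c \<tau> - r * boundary (coboundary X w c) \<tau>)" for c
  define a where "a m = (R ^^ m) z" for m
  have R: "R c \<in> cycles X i" if "c \<in> cycles X i" for c
  proof -
    have "coboundary X w c \<in> chains X (i + 1)"
      using that coboundary_in_chains[OF V] by (auto simp: cycles_def)
    then have "boundary (coboundary X w c) \<in> cycles X i"
      using boundary_in_chains[OF V down] boundary_boundary[OF V down] by (auto simp: cycles_def)
    then show ?thesis
      unfolding R_def by (rule cycles_diff_scale[OF V that])
  qed
  have a: "a m \<in> cycles X i" for m
    by (induction m) (auto simp: a_def z R)
  have ac: "a m \<in> chains X i" for m
    using a by (auto simp: cycles_def)
  have supp: "set \<sigma> \<in> X \<and> int (length \<sigma>) = i + 1" if "a m \<sigma> \<noteq> 0" for m \<sigma>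
    using ac[of m] that by (auto simp: chains_iff)
  \<comment> \<open>A sum in place of the weighted maximum: it dominates each of its finitely many
    terms, and it is 0 if \<open>z\<close> vanishes.\<close>
  define K where "K = (\<Sum>\<sigma> | z \<sigma> \<noteq> 0. \<bar>z \<sigma>\<bar> / N \<sigma>)"
  have fin: "finite {\<sigma>. z \<sigma> \<noteq> 0}" and zX: "\<And>\<sigma>. z \<sigma> \<noteq> 0 \<Longrightarrow> set \<sigma> \<in> X"
    using z by (auto simp: cycles_def chains_iff)
  have K0: "0 \<le> K"
    unfolding K_def by (intro sum_nonneg) (simp add: N zX less_imp_le)
  have K: "\<bar>z \<sigma>\<bar> \<le> K * N \<sigma>" if "set \<sigma> \<in> X" for \<sigma>
  proof (cases "z \<sigma> = 0")
    case True
    then show ?thesis using K0 N[OF that] by simp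
  next
    case False
    have "\<bar>z \<sigma>\<bar> / N \<sigma> \<le> K"
      unfolding K_def
      by (rule member_le_sum[where f = "\<lambda>\<sigma>. \<bar>z \<sigma>\<bar> / N \<sigma>"]) (use False fin N zX in \<open>auto simp: less_imp_le\<close>)
    then show ?thesis using N[OF that] by (simp add: divide_simps)
  qed
  have bound: "\<bar>a m \<sigma>\<bar> \<le> q ^ m * K * N \<sigma>" if "set \<sigma> \<in> X" for m \<sigma>
    using that
  proof (induction m arbitrary: \<sigma>)
    case 0
    then show ?case by (simp add: a_def K)
  next
    case (Suc m)
    show ?case
    \<comment> \<open>The contraction is assumed only at lists of length i + 1; at all others the
      iterates vanish.\<close>
    proof (cases "int (length \<sigma>) = i + 1")
      case True
      have "\<bar>a m \<sigma> - r * boundary (coboundary X w (a m)) \<sigma>\<bar> \<le> q * (q ^ m * K) * N \<sigma>"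
        by (rule contr) (use a Suc True K0 q in auto)
      then show ?thesis by (simp add: a_def R_def mult.assoc)
    next
      case False
      then have "a (Suc m) \<sigma> = 0" using supp[of "Suc m" \<sigma>] by auto
      then show ?thesis using K0 q N[OF Suc.prems] by (simp add: less_imp_le)
    qed
  qed
  have summable: "summable (\<lambda>m. a m \<sigma>)" for \<sigma>
  proof (cases "set \<sigma> \<in> X")
    case True
    have "summable (\<lambda>m. q ^ m * (K * N \<sigma>))"
      using q by (intro summable_mult2 summable_geometric) auto
    then show ?thesis
      by (rule summable_comparison_test[rotated]) (use bound[OF True] in \<open>auto simp: mult.assoc\<close>)
  next
    case False
    then have "(\<lambda>m. a m \<sigma>) = (\<lambda>_. 0)" using supp by blast
    then show ?thesis by simp
  qed
  define c where "c \<sigma> = (\<Sum>m. a m \<sigma>)" for \<sigma>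
  have sums: "(\<lambda>m. a m \<sigma>) sums c \<sigma>" for \<sigma>
    unfolding c_def by (rule summable_sums[OF summable])
  have c: "c \<in> chains X i"
  proof (rule chainsI[OF V])
    fix \<sigma>
    assume "c \<sigma> \<noteq> 0"
    then obtain m where "a m \<sigma> \<noteq> 0"
      unfolding c_def by force
    then show "distinct \<sigma> \<and> set \<sigma> \<in> X \<and> int (length \<sigma>) = i + 1"
      using ac[of m] by (auto simp: chains_iff)
  next
    have "a m (xs @ u # v # ys) = - a m (xs @ v # u # ys)" for m xs u v ys
      using ac[of m] unfolding chains_iff alternating_def by blast
    then have "c (xs @ u # v # ys) = (\<Sum>m. - a m (xs @ v # u # ys))" for xs u v ys
      unfolding c_def by (rule arg_cong[OF ext])
    then show "alternating c"
      unfolding alternating_def c_def suminf_minus[OF summable] by blast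
  qed
  \<comment> \<open>Both \<open>coboundary\<close> and \<open>boundary\<close> are finite linear
    combinations of values, so they commute with the pointwise limit.\<close>
  have "(\<lambda>m. coboundary X w (a m) \<sigma>) sums coboundary X w c \<sigma>" for \<sigma>
    by (simp add: coboundary_def wedge_sums[OF sums])
  then have S: "(\<lambda>m. r * boundary (coboundary X w (a m)) \<tau>) sums (r * boundary (coboundary X w c) \<tau>)" for \<tau>
    unfolding boundary_eq_sum[OF V coboundary_in_chains[OF V ac]]
      boundary_eq_sum[OF V coboundary_in_chains[OF V c]]
    by (intro sums_mult sums_sum)
  have "z \<tau> = r * boundary (coboundary X w c) \<tau>" for \<tau>
  proof -
    have "(\<lambda>m. a m \<tau> - a (Suc m) \<tau>) sums (a 0 \<tau> - 0)"
      by (rule telescope_sums') (rule summable_LIMSEQ_zero[OF summable])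
    moreover have "a m \<tau> - a (Suc m) \<tau> = r * boundary (coboundary X w (a m)) \<tau>" for m
      by (simp add: a_def R_def)
    ultimately show ?thesis
      using S[of \<tau>] sums_unique2 by (fastforce simp: a_def)
  qed
  moreover have cb: "coboundary X w c \<in> chains X (i + 1)"
    by (rule coboundary_in_chains[OF V c])
  moreover have "(\<lambda>\<sigma>. 0) \<in> chains X (i + 1)"
    by (auto simp: chains_iff alternating_def)
  then have rc: "(\<lambda>\<sigma>. r * coboundary X w c \<sigma>) \<in> chains X (i + 1)"
    using chains_diff_scale[OF V _ cb, of "\<lambda>_. 0" "- r"] by simp
  ultimately have "z = boundary (\<lambda>\<sigma>. r * coboundary X w c \<sigma>)"
    by (auto simp: fun_eq_iff boundary_eq_sum[OF V rc] boundary_eq_sum[OF V cb] sum_distrib_left)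
  then show ?thesis
    using rc unfolding boundaries_def by blast
qed

section \<open>Diagonal dominance for independence complexes\<close>

lemma independence_complex_mono:
  "\<forall>S\<in>independence_complex V E. \<forall>T\<subseteq>S. T \<in> independence_complex V E"
  unfolding independence_complex_def by blast

lemma independence_complex_subset: "independence_complex V E \<subseteq> Pow V"
  unfolding independence_complex_def by blast

text \<open>The offending edge must contain \<open>v\<close>, and as its two ends are distinct, the
  other one lies in \<open>S\<close>.\<close>

lemma independence_complex_extension:
  assumes G: "simple_graph V E" and \<tau>: "S \<in> independence_complex V E"
    and v: "v \<in> V" "insert v S \<notin> independence_complex V E"
  obtains u where "u \<in> S" "v \<in> neighbours E u"
proof -
  obtain e where e: "e \<in> E" "e \<subseteq> insert v S"
    using \<tau> v by (auto simp: independence_complex_def)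
  moreover have "\<not> e \<subseteq> S" using \<tau> e by (auto simp: independence_complex_def)
  moreover obtain a b where "e = {a, b}" "a \<noteq> b"
    using G e by (auto simp: simple_graph_def)
  ultimately show ?thesis
    using that[of a] that[of b] by (auto simp: neighbours_def insert_commute)
qed

lemma neighbours_subset: "simple_graph V E \<Longrightarrow> neighbours E v \<subseteq> V"
  unfolding simple_graph_def neighbours_def by (fastforce simp: doubleton_eq_iff)

text \<open>A vertex \<open>v\<close> adjacent to \<open>\<tau>\<close> can replace the \<open>j\<close>-th vertex of \<open>\<tau>\<close> only if that is its unique
  neighbour in \<open>\<tau>\<close>, so only the neighbours of \<open>v\<close> contribute.\<close>

lemma wedge_adjacent_bound:
  fixes f :: "'a \<Rightarrow> real"
  assumes G: "simple_graph V E"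
    and f: "\<And>v. v \<in> V \<Longrightarrow> 0 < f v"
    and c: "c \<in> chains (independence_complex V E) i" and K: "0 \<le> K"
    and cK: "\<And>\<sigma>. set \<sigma> \<in> independence_complex V E \<Longrightarrow> \<bar>c \<sigma>\<bar> \<le> K * prod_list (map f \<sigma>)"
    and \<tau>: "set \<tau> \<in> independence_complex V E" and v: "v \<in> V"
    and adj: "u \<in> set \<tau>" "v \<in> neighbours E u"
  shows "\<bar>wedge (\<lambda>v. (f v)\<^sup>2) c (v # \<tau>)\<bar> \<le> K * prod_list (map f \<tau>) *
    (\<Sum>j<length \<tau>. if v \<in> neighbours E (\<tau> ! j) then f v * (f v + f (\<tau> ! j)) else 0)"
proof -
  let ?P = "prod_list (map f \<tau>)"
  have \<tau>V: "set \<tau> \<subseteq> V" using \<tau> by (auto simp: independence_complex_def)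
  have pos: "0 < prod_list (map f \<rho>)" if "set \<rho> \<subseteq> V" for \<rho>
    using that by (induction \<rho>) (auto simp: f)
  note P = pos[OF \<tau>V]
  \<comment> \<open>The term that deletes \<open>v\<close>: the sum on the right contains at least
    the summand of the given neighbour \<open>u\<close>.\<close>
  have 1: "\<bar>(f v)\<^sup>2 * c \<tau>\<bar> \<le> K * ?P * (\<Sum>j<length \<tau>. if v \<in> neighbours E (\<tau> ! j) then (f v)\<^sup>2 else 0)"
  proof -
    obtain j where j: "j < length \<tau>" "\<tau> ! j = u"
      using adj(1) by (metis in_set_conv_nth)
    have "(f v)\<^sup>2 \<le> (\<Sum>j<length \<tau>. if v \<in> neighbours E (\<tau> ! j) then (f v)\<^sup>2 else 0)"
      using member_le_sum[of j "{..<length \<tau>}" "\<lambda>j. if v \<in> neighbours E (\<tau> ! j) then (f v)\<^sup>2 else 0"]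
        j adj(2) by simp
    then have "\<bar>c \<tau>\<bar> * (f v)\<^sup>2 \<le> K * ?P * (\<Sum>j<length \<tau>. if v \<in> neighbours E (\<tau> ! j) then (f v)\<^sup>2 else 0)"
      using cK[OF \<tau>] by (intro mult_mono) (use K P in auto)
    then show ?thesis by (simp add: abs_mult mult.commute)
  qed
  \<comment> \<open>The term that keeps \<open>v\<close> and deletes the \<open>j\<close>-th vertex
    of \<tau>.\<close>
  have 2: "\<bar>(- 1) ^ j * (f (\<tau> ! j))\<^sup>2 * c (v # take j \<tau> @ drop (Suc j) \<tau>)\<bar>
      \<le> K * ?P * (if v \<in> neighbours E (\<tau> ! j) then f v * f (\<tau> ! j) else 0)" (is "?L \<le> _")
    if j: "j < length \<tau>" for j
  proof -
    let ?\<rho> = "take j \<tau> @ drop (Suc j) \<tau>"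
    have \<tau>_eq: "\<tau> = take j \<tau> @ \<tau> ! j # drop (Suc j) \<tau>"
      using j by (rule id_take_nth_drop)
    have P_eq: "?P = f (\<tau> ! j) * prod_list (map f ?\<rho>)"
      by (subst \<tau>_eq) (simp add: mult_ac)
    have \<rho>V: "set ?\<rho> \<subseteq> V"
      using \<tau>V by (auto dest: in_set_takeD in_set_dropD)
    have fj: "0 < f (\<tau> ! j)" using nth_mem[OF j] \<tau>V f by blast
    show ?thesis
    proof (cases "c (v # ?\<rho>) = 0")
      case True
      then show ?thesis using K P f[OF v] fj by simp
    next
      case False
      then have ind: "set (v # ?\<rho>) \<in> independence_complex V E"
        using c unfolding chains_iff by blast
      have "v \<in> neighbours E (\<tau> ! j)"
      \<comment> \<open>Otherwise \<open>u\<close> survives the deletion and the edge between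
        \<open>u\<close> and \<open>v\<close> lies in a simplex.\<close>
      proof (rule ccontr)
        assume "v \<notin> neighbours E (\<tau> ! j)"
        then have "u \<noteq> \<tau> ! j" using adj by auto
        then have "u \<in> set ?\<rho>"
          using adj(1) by (subst (asm) \<tau>_eq) auto
        then have "{v, u} \<subseteq> set (v # ?\<rho>)" by auto
        moreover have "{v, u} \<in> E" using adj(2) by (simp add: neighbours_def)
        ultimately show False using ind unfolding independence_complex_def by blast
      qed
      moreover have "?L \<le> (f (\<tau> ! j))\<^sup>2 * (K * prod_list (map f (v # ?\<rho>)))"
        using cK[OF ind] by (simp add: abs_mult power_abs mult_left_mono)
      \<comment> \<open>Replacing \<open>\<tau> ! j\<close> by \<open>v\<close> multiplies the norm
        weight by \<open>f v / f (\<tau> ! j)\<close>. This turns the squared weight into the mixed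
        product of the packing condition.\<close>
      moreover have "(f (\<tau> ! j))\<^sup>2 * (K * prod_list (map f (v # ?\<rho>))) = K * ?P * (f v * f (\<tau> ! j))"
        unfolding P_eq by (simp add: power2_eq_square mult_ac)
      ultimately show ?thesis by (simp only: if_True)
    qed
  qed
  have "\<bar>wedge (\<lambda>v. (f v)\<^sup>2) (\<lambda>\<rho>. c (v # \<rho>)) \<tau>\<bar>
      \<le> (\<Sum>j<length \<tau>. K * ?P * (if v \<in> neighbours E (\<tau> ! j) then f v * f (\<tau> ! j) else 0))"
    unfolding wedge_def by (rule order.trans[OF sum_abs sum_mono]) (rule 2, simp)
  with 1 have "\<bar>wedge (\<lambda>v. (f v)\<^sup>2) c (v # \<tau>)\<bar> \<le>
      K * ?P * (\<Sum>j<length \<tau>. if v \<in> neighbours E (\<tau> ! j) then (f v)\<^sup>2 else 0) +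
      K * ?P * (\<Sum>j<length \<tau>. if v \<in> neighbours E (\<tau> ! j) then f v * f (\<tau> ! j) else 0)"
    unfolding wedge_Cons sum_distrib_left by linarith
  also have "\<dots> = K * ?P *
    (\<Sum>j<length \<tau>. if v \<in> neighbours E (\<tau> ! j) then f v * (f v + f (\<tau> ! j)) else 0)"
    unfolding distrib_left[symmetric] sum.distrib[symmetric]
    by (intro arg_cong2[of _ _ _ _ "(*)"] sum.cong) (auto simp: algebra_simps power2_eq_square)
  finally show ?thesis .
qed

text \<open>Summing the error bound over v and exchanging the sums leaves one packing sum for each
  of the i + 1 vertices of \<tau>, each at most \<open>b\<close>. Positivity of \<open>f\<close>
  provides the norm weights, and a general \<open>b\<close> leaves room for perturbing a
  packing.\<close>

lemma reduced_homology_independence_complex_zero: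
  fixes f :: "'a \<Rightarrow> real"
  assumes G: "simple_graph V E"
    and f: "\<And>v. v \<in> V \<Longrightarrow> 0 < f v"
    and b: "\<And>v. v \<in> V \<Longrightarrow> (\<Sum>u\<in>neighbours E v. f u * (f u + f v)) \<le> b" "0 \<le> b"
    and i: "- 1 \<le> i" "of_int (i + 1) * b < (\<Sum>v\<in>V. (f v)\<^sup>2)"
  shows "reduced_homology_zero (independence_complex V E) i"
proof -
  let ?X = "independence_complex V E"
  define w where "w = (\<lambda>v. (f v)\<^sup>2)"
  define W where "W = (\<Sum>v\<in>V. w v)"
  define q where "q = of_int (i + 1) * b / W"
  have V: "finite V" "?X \<subseteq> Pow V"
    using G by (simp_all add: simple_graph_def independence_complex_subset)
  have ib: "0 \<le> of_int (i + 1) * b" using i b by simp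
  \<comment> \<open>The strict inequality in \<open>i\<close> gives this even for i = -1.\<close>
  have W: "0 < W" using i(2) ib by (simp add: W_def w_def)
  have q: "0 \<le> q" "q < 1"
    using ib i(2) W by (simp_all add: q_def W_def w_def)
  have pos: "0 < prod_list (map f \<rho>)" if "set \<rho> \<in> ?X" for \<rho>
  proof -
    have "set \<rho> \<subseteq> V" using that V by blast
    then show ?thesis by (induction \<rho>) (auto simp: f)
  qed
  have contr: "\<bar>c \<tau> - 1 / W * boundary (coboundary ?X w c) \<tau>\<bar> \<le> q * K * prod_list (map f \<tau>)"
    if c: "c \<in> cycles ?X i" and K: "0 \<le> K"
      and cK: "\<And>\<sigma>. set \<sigma> \<in> ?X \<Longrightarrow> \<bar>c \<sigma>\<bar> \<le> K * prod_list (map f \<sigma>)"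
      and \<tau>: "set \<tau> \<in> ?X" "int (length \<tau>) = i + 1" for c K \<tau>
  proof -
    let ?P = "prod_list (map f \<tau>)"
    let ?B = "{v\<in>V. insert v (set \<tau>) \<notin> ?X}"
    let ?g = "\<lambda>v j. if v \<in> neighbours E (\<tau> ! j) then f v * (f v + f (\<tau> ! j)) else 0"
    have \<tau>V: "\<tau> ! j \<in> V" if "j < length \<tau>" for j
      using \<tau>(1) nth_mem[OF that] V(2) by blast
    have KP: "0 \<le> K * ?P" using K pos[OF \<tau>(1)] by simp
    \<comment> \<open>The choice r = 1 / W cancels the main term and leaves only the error.\<close>
    have eq: "c \<tau> - 1 / W * boundary (coboundary ?X w c) \<tau> = (\<Sum>v\<in>?B. wedge w c (v # \<tau>)) / W"
      using W unfolding boundary_coboundary_cycle[OF V c \<tau>(1)] W_def[symmetric]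
      by (simp add: field_simps)
    have "\<bar>\<Sum>v\<in>?B. wedge w c (v # \<tau>)\<bar> \<le> (\<Sum>v\<in>?B. K * ?P * (\<Sum>j<length \<tau>. ?g v j))"
    proof (rule order.trans[OF sum_abs], rule sum_mono)
      fix v
      assume v: "v \<in> ?B"
      then obtain u where u: "u \<in> set \<tau>" "v \<in> neighbours E u"
        using independence_complex_extension[OF G \<tau>(1)] by blast
      show "\<bar>wedge w c (v # \<tau>)\<bar> \<le> K * ?P * (\<Sum>j<length \<tau>. ?g v j)"
        unfolding w_def
        by (rule wedge_adjacent_bound[OF G f _ K cK \<tau>(1) _ u]) (use c v in \<open>auto simp: cycles_def\<close>)
    qed
    \<comment> \<open>The added summands are nonnegative, and summing over all of \<open>V\<close>
      allows the exchange of sums.\<close>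
    also have "\<dots> \<le> (\<Sum>v\<in>V. K * ?P * (\<Sum>j<length \<tau>. ?g v j))"
      using V(1) by (intro sum_mono2 mult_nonneg_nonneg[OF KP] sum_nonneg)
        (auto simp: f \<tau>V less_imp_le add_pos_pos)
    also have "\<dots> = K * ?P * (\<Sum>j<length \<tau>. \<Sum>v\<in>V. ?g v j)"
      unfolding sum_distrib_left[symmetric] by (subst sum.swap) simp
    also have "\<dots> \<le> K * ?P * (\<Sum>j<length \<tau>. b)"
    proof (rule mult_left_mono[OF sum_mono KP])
      fix j assume "j \<in> {..<length \<tau>}"
      then have "(\<Sum>u\<in>neighbours E (\<tau> ! j). f u * (f u + f (\<tau> ! j))) \<le> b"
        using b(1) \<tau>V by simp
      moreover have "{v\<in>V. v \<in> neighbours E (\<tau> ! j)} = neighbours E (\<tau> ! j)"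
        using neighbours_subset[OF G] by blast
      ultimately show "(\<Sum>v\<in>V. ?g v j) \<le> b"
        by (simp add: sum.inter_filter[OF V(1), symmetric])
    qed
    also have "(\<Sum>j<length \<tau>. b) = of_int (i + 1) * b"
      by (simp flip: \<tau>(2))
    finally have "\<bar>\<Sum>v\<in>?B. wedge w c (v # \<tau>)\<bar> / W \<le> K * ?P * (of_int (i + 1) * b) / W"
      using W by (simp add: divide_right_mono)
    then show ?thesis
      unfolding eq using W by (simp add: q_def mult_ac)
  qed
  have "z \<in> boundaries ?X i" if "z \<in> cycles ?X i" for z
    by (rule cycle_is_boundary_of_contraction[OF V independence_complex_mono pos q contr that])
  then have "cycles ?X i \<subseteq> boundaries ?X i" by blast
  then show ?thesis
    by (rule reduced_homology_zeroI[OF V independence_complex_mono])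
qed

section \<open>From packings to the connectivity bound\<close>

lemma reduced_homology_zero_below:
  assumes "finite V" "X \<subseteq> Pow V" "\<forall>S\<in>X. \<forall>T\<subseteq>S. T \<in> X" "i < - 1"
  shows "reduced_homology_zero X i"
proof (rule reduced_homology_zeroI[OF assms(1-3)])
  show "cycles X i \<subseteq> boundaries X i"
  proof
    fix z assume "z \<in> cycles X i"
    then have "z \<sigma> = 0" for \<sigma>
      using assms(4) by (fastforce simp: cycles_def chains_iff)
    then have "z = boundary (\<lambda>_. 0)" by (auto simp: boundary_def)
    then show "z \<in> boundaries X i"
      unfolding boundaries_def by (auto simp: chains_iff alternating_def)
  qed
qed

text \<open>A packing may vanish at some vertices, so a small constant is added to it. The strict
  hypothesis absorbs the resulting increase of the packing bound.\<close>

lemma reduced_homology_zero_of_packing: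
  assumes G: "simple_graph V E" and f: "fractional_quadratic_packing V E f"
    and i: "of_int (i + 1) < (\<Sum>v\<in>V. (f v)\<^sup>2)"
  shows "reduced_homology_zero (independence_complex V E) i"
proof -
  have V: "finite V" using G by (simp add: simple_graph_def)
  show ?thesis
  proof (cases "i < - 1")
    case True
    then show ?thesis
      by (rule reduced_homology_zero_below[OF V independence_complex_subset independence_complex_mono])
  next
    case False
    let ?m = "of_int (i + 1) :: real"
    let ?W = "\<Sum>v\<in>V. (f v)\<^sup>2"
    have f0: "0 \<le> f v" and f1: "(\<Sum>u\<in>neighbours E v. f u * (f u + f v)) \<le> 1" if "v \<in> V" for v
      using f that by (auto simp: fractional_quadratic_packing_def)
    have m: "0 \<le> ?m" using False by simp
    \<comment> \<open>This gives m b = m + (W - m) m / (m + 1) < W with b > 1; the denominator m + 1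
      is positive also for m = 0.\<close>
    define b where "b = 1 + (?W - ?m) / (?m + 1)"
    have b1: "1 < b" using m i by (simp add: b_def)
    have "?m * (?W - ?m) < (?W - ?m) * (?m + 1)"
      using i m by (simp add: algebra_simps)
    then have mb: "?m * b < ?W"
      using m by (simp add: b_def field_simps)
    \<comment> \<open>Each packing sum is continuous in the shift e and at most 1 < b at e = 0.
      Since \<open>V\<close> is finite, one e > 0 then serves all vertices.\<close>
    have "\<forall>v\<in>V. \<forall>\<^sub>F e in at_right 0. (\<Sum>u\<in>neighbours E v. (f u + e) * ((f u + e) + (f v + e))) < b"
    proof
      fix v assume v: "v \<in> V"
      have "((\<lambda>e. \<Sum>u\<in>neighbours E v. (f u + e) * ((f u + e) + (f v + e))) \<longlongrightarrow>
         (\<Sum>u\<in>neighbours E v. (f u + 0) * ((f u + 0) + (f v + 0)))) (at_right 0)"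
        by (intro tendsto_intros)
      moreover have "(\<Sum>u\<in>neighbours E v. (f u + 0) * ((f u + 0) + (f v + 0))) < b"
        using f1[OF v] b1 by simp
      ultimately show "\<forall>\<^sub>F e in at_right 0. (\<Sum>u\<in>neighbours E v. (f u + e) * ((f u + e) + (f v + e))) < b"
        by (rule order_tendstoD(2))
    qed
    then have "\<forall>\<^sub>F e in at_right 0. 0 < e \<and>
        (\<forall>v\<in>V. (\<Sum>u\<in>neighbours E v. (f u + e) * ((f u + e) + (f v + e))) < b)"
      using V by (intro eventually_conj eventually_at_right_less) (simp add: eventually_ball_finite)
    then obtain e where e: "0 < e"
      "\<And>v. v \<in> V \<Longrightarrow> (\<Sum>u\<in>neighbours E v. (f u + e) * ((f u + e) + (f v + e))) < b"
      using eventually_happens[of _ "at_right (0::real)"] by force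
    have "?W \<le> (\<Sum>v\<in>V. (f v + e)\<^sup>2)"
      using f0 e by (intro sum_mono power_mono) auto
    with mb have "?m * b < (\<Sum>v\<in>V. (f v + e)\<^sup>2)" by linarith
    then show ?thesis
      using e f0 False b1
      by (intro reduced_homology_independence_complex_zero[OF G, of "\<lambda>v. f v + e" b])
         (auto simp: add_nonneg_pos less_imp_le)
  qed
qed

theorem theorem1p6:
  fixes V :: "'a set" and E :: "'a set set"
  assumes "simple_graph V E"
  shows "ereal_of_enat (homological_connectivity (independence_complex V E)) \<ge> rho_q V E"
  unfolding rho_q_def
proof (rule SUP_least)
  fix f
  assume "f \<in> {f. fractional_quadratic_packing V E f}"
  then have f: "fractional_quadratic_packing V E f" by simp
  let ?W = "\<Sum>v\<in>V. (f v)\<^sup>2"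
  \<comment> \<open>Rounding up is possible because i \<le> k - 2 means that i + 1 is less than the
    ceiling of the sum, hence less than the sum itself.\<close>
  define k where "k = nat \<lceil>?W\<rceil>"
  have W: "0 \<le> ?W" by (simp add: sum_nonneg)
  have "reduced_homology_zero (independence_complex V E) i" if "i \<le> int k - 2" for i
  proof (rule reduced_homology_zero_of_packing[OF assms f])
    have "i + 1 < \<lceil>?W\<rceil>" using that W by (simp add: k_def)
    then show "of_int (i + 1) < ?W" by (simp add: less_ceiling_iff)
  qed
  then have "enat k \<le> homological_connectivity (independence_complex V E)"
    unfolding homological_connectivity_def by (intro Sup_upper) blast
  then have "ereal_of_enat (enat k) \<le> ereal_of_enat (homological_connectivity (independence_complex V E))"
    by (simp only: ereal_of_enat_le_iff)
  moreover have "ereal ?W \<le> ereal_of_enat (enat k)"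
    using W by (simp add: k_def)
  ultimately show "ereal ?W \<le> ereal_of_enat (homological_connectivity (independence_complex V E))"
    by (rule order.trans[rotated])
qed

end
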